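(* Let $d\ge1$ and let $K\subset\mathbb{R}^d$ be any closed convex set. Then there exists $0\le u_0\in\mathcal{M}_{\rm loc}(\mathbb{R}^d)$ with optimal index $0<\varepsilon_0(u_0)<\infty$ such that, with $T=\frac{1}{4\varepsilon_0(u_0)}$ and $$u(x,t)=\frac{1}{(4\pi t)^{d/2}}\int_{\mathbb{R}^d}e^{-|x-y|^2/4t}\,\mathrm{d}u_0(y),\qquad x\in\mathbb{R}^d,\ 0<t<T,$$ the limit $\lim_{t\to T^-}u(x,t)$ is finite if and only if $x\in K$.
   Context: $\mathcal{M}_{\rm loc}(\mathbb{R}^d)$ is the set of (signed) Radon measures on $\mathbb{R}^d$, identified with the dual of $C_c(\mathbb{R}^d)$; a function $f\in L^1_{\rm loc}(\mathbb{R}^d)$ is identified with the measure $f\,\mathrm{d}x$; $|\mu|$ is the total variation measure. For $\varepsilon>0$, $\mathcal{M}_\varepsilon(\mathbb{R}^d)=\{\mu\in\mathcal{M}_{\rm loc}(\mathbb{R}^d):\int e^{-\varepsilon|x|^2}\,\mathrm{d}|\mu|(x)<\infty\}$. The optimal index of $\mu$ is $\varepsilon_0(\mu)=\inf\{\varepsilon>0:\mu\in\mathcal{M}_\varepsilon(\mathbb{R}^d)\}$. For $0\le u_0\in\mathcal M_{\rm loc}(\mathbb R^d)$ with $0<\varepsilon_0(u_0)<\infty$, $u(x,t)$ is finite for all $x$ and $0<t<T$, and for every $x$ the limit as $t\to T^-$ exists in $[0,\infty]$. *)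

theory Defs
  imports "HOL-Analysis.Analysis"
begin

text \<open>The nonnegative cone of \<open>M\<^sub>l\<^sub>o\<^sub>c\<close>: on a Euclidean space every locally finite Borel
  measure is regular, hence Radon, and such measures are exactly the nonnegative functionals on
  continuous functions with compact support. For them the total variation \<open>\<bar>\<mu>\<bar>\<close> is \<open>\<mu>\<close> itself.\<close>

definition nonneg_radon :: "'a::euclidean_space measure set" where
  "nonneg_radon = {\<mu>. sets \<mu> = sets borel \<and> (\<forall>C. compact C \<longrightarrow> emeasure \<mu> C < \<infinity>)}"

definition nonneg_radon_eps :: "real \<Rightarrow> 'a::euclidean_space measure set" where
  "nonneg_radon_eps \<epsilon> =
     {\<mu> \<in> nonneg_radon. (\<integral>\<^sup>+ x. ennreal (exp (- \<epsilon> * (norm x)\<^sup>2)) \<partial>\<mu>) < \<infinity>}"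

text \<open>The infimum is taken in the extended reals, so that it is \<open>\<infinity>\<close> when no \<open>\<epsilon>\<close> qualifies.\<close>

definition optimal_index :: "'a::euclidean_space measure \<Rightarrow> ereal" where
  "optimal_index \<mu> = Inf (ereal ` {\<epsilon>. \<epsilon> > 0 \<and> \<mu> \<in> nonneg_radon_eps \<epsilon>})"

definition heat_solution :: "'a::euclidean_space measure \<Rightarrow> 'a \<Rightarrow> real \<Rightarrow> ennreal" where
  "heat_solution \<mu> x t =
     ennreal (1 / (4 * pi * t) powr (real DIM('a) / 2)) *
     (\<integral>\<^sup>+ y. ennreal (exp (- ((norm (x - y))\<^sup>2 / (4 * t)))) \<partial>\<mu>)"

end

theory Submission
  imports Defs "HOL-Real_Asymp.Real_Asymp"
begin

text \<open>
  As \<open>t\<close> increases to \<open>T\<close> the Gaussian kernel increases pointwise, apart from the continuous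
  normalising factor, so by monotone convergence the limit of the heat solution is its value at
  \<open>T\<close>. Normalise the optimal index to \<open>1\<close>, that is \<open>T = 1/4\<close>, and write
  \<open>u\<^sub>0 = exp (\<bar>y\<bar>\<^sup>2) N\<close>. Completing the square,
  \<open>exp (\<bar>y\<bar>\<^sup>2 - \<bar>x - y\<bar>\<^sup>2) = exp (- \<bar>x\<bar>\<^sup>2) exp (2 x \<bullet> y)\<close>, so the limit at \<open>x\<close> is finite exactly
  when the exponential moment \<open>\<integral> exp (2 x \<bullet> y) dN\<close> is finite
  (\<open>heat_solution_gauss_weighted\<close>), and the index of \<open>u\<^sub>0\<close> is \<open>1\<close> as soon as
  \<open>\<integral> exp (\<delta> \<bar>y\<bar>\<^sup>2) dN\<close> is finite for \<open>\<delta> < 0\<close> and infinite for \<open>\<delta> > 0\<close>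
  (\<open>optimal_index_gauss_weighted\<close>). The task is thus to realise \<open>K\<close> as the domain of finiteness
  of the exponential moments of a measure (\<open>exp_moment_domain\<close>).

  For a proper subset \<open>K\<close>, write it as the intersection of countably many half-spaces
  \<open>a\<^sub>k \<bullet> x \<le> b\<^sub>k\<close> with unit normals, and put on each ray \<open>m a\<^sub>k\<close>, \<open>m = 0, 1, 2, \<dots>\<close>, point
  masses \<open>exp (- 2 m b\<^sub>k)\<close>, damped by the summable factor \<open>2\<^sup>-\<^sup>k (m + 1)\<^sup>-\<^sup>2\<close>. The exponential moment
  is then the sum of \<open>exp (2 m (a\<^sub>k \<bullet> x - b\<^sub>k))\<close> times this factor: it is bounded by a convergent
  sum on \<open>K\<close>, and one violated half-space makes it diverge, because polynomial damping cannot
  compensate exponential growth. The Gaussian moments for \<open>\<delta> < 0\<close> need \<open>b\<^sub>k\<close> bounded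
  below; a point of \<open>K\<close> provides such a bound, and the empty set is the intersection of two
  opposite half-spaces. The whole space is served by a Poisson distribution on a ray, whose
  exponential moments are all finite although its Gaussian moments are not.
\<close>

section \<open>Reduction to exponential moments\<close>

definition exp_moment :: "'a::euclidean_space measure \<Rightarrow> 'a \<Rightarrow> ennreal" where
  "exp_moment N x = (\<integral>\<^sup>+ y. ennreal (exp (2 * (x \<bullet> y))) \<partial>N)"

definition gauss_moment :: "'a::euclidean_space measure \<Rightarrow> real \<Rightarrow> ennreal" where
  "gauss_moment N \<delta> = (\<integral>\<^sup>+ y. ennreal (exp (\<delta> * (norm y)\<^sup>2)) \<partial>N)"

definition gauss_weighted :: "'a::euclidean_space measure \<Rightarrow> 'a measure" where
  "gauss_weighted N = density N (\<lambda>y. ennreal (exp ((norm y)\<^sup>2)))"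

definition point_masses :: "('i \<Rightarrow> real) \<Rightarrow> ('i \<Rightarrow> 'a::euclidean_space) \<Rightarrow> 'a measure" where
  "point_masses w p = distr (density (count_space UNIV) (\<lambda>i. ennreal (w i))) borel p"

text \<open>This is where the limit comes from: for fixed \<open>x\<close> and \<open>y\<close> the exponential factor increases with
  time, so monotone convergence applies even if the value at \<open>T\<close> is infinite.\<close>

lemma heat_solution_left_continuous:
  fixes \<mu> :: "'a::euclidean_space measure"
  assumes [measurable_cong]: "sets \<mu> = sets borel" and T: "T > 0"
  shows "(heat_solution \<mu> x \<longlongrightarrow> heat_solution \<mu> x T) (at_left T)"
proof -
  let ?I = "\<lambda>t. \<integral>\<^sup>+ y. ennreal (exp (- ((norm (x - y))\<^sup>2 / (4 * t)))) \<partial>\<mu>"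
  have I: "(?I \<longlongrightarrow> ?I T) (at_left T)"
  proof (rule tendsto_at_left_sequentially[of 0 T])
    fix S :: "nat \<Rightarrow> real"
    assume S: "\<And>n. S n < T" "\<And>n. 0 < S n" "incseq S" "S \<longlonglongrightarrow> T"
    show "(\<lambda>n. ?I (S n)) \<longlonglongrightarrow> ?I T"
    proof (rule nn_integral_LIMSEQ)
      show "incseq (\<lambda>n y. ennreal (exp (- ((norm (x - y))\<^sup>2 / (4 * S n)))))"
      proof (intro incseq_SucI le_funI ennreal_leI)
        fix n y
        have "S n \<le> S (Suc n)" using S(3) by (rule incseq_SucD)
        then show "exp (- ((norm (x - y))\<^sup>2 / (4 * S n))) \<le> exp (- ((norm (x - y))\<^sup>2 / (4 * S (Suc n))))"
          using S(2) by (auto intro!: divide_left_mono)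
      qed
      show "(\<lambda>n. ennreal (exp (- ((norm (x - y))\<^sup>2 / (4 * S n)))))
              \<longlonglongrightarrow> ennreal (exp (- ((norm (x - y))\<^sup>2 / (4 * T))))" for y
        using T by (intro tendsto_intros tendsto_ennrealI S(4)) auto
    qed auto
  qed (use T in auto)
  have "((\<lambda>t. 1 / (4 * pi * t) powr (real DIM('a) / 2)) \<longlongrightarrow> 1 / (4 * pi * T) powr (real DIM('a) / 2)) (at_left T)"
    using T by (intro tendsto_intros) auto
  then have "((\<lambda>t. ennreal (1 / (4 * pi * t) powr (real DIM('a) / 2)))
      \<longlongrightarrow> ennreal (1 / (4 * pi * T) powr (real DIM('a) / 2))) (at_left T)"
    by (rule tendsto_ennrealI)
  then have "((\<lambda>t. ennreal (1 / (4 * pi * t) powr (real DIM('a) / 2)) * ?I t)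
      \<longlongrightarrow> ennreal (1 / (4 * pi * T) powr (real DIM('a) / 2)) * ?I T) (at_left T)"
    by (rule tendsto_mult_ennreal[OF _ I]) (use T in \<open>auto simp: ennreal_eq_0_iff\<close>)
  then show ?thesis
    unfolding heat_solution_def[abs_def] .
qed

lemma heat_solution_gauss_weighted:
  fixes N :: "'a::euclidean_space measure"
  assumes [measurable_cong]: "sets N = sets borel"
  shows "heat_solution (gauss_weighted N) x (1/4) < \<infinity> \<longleftrightarrow> exp_moment N x < \<infinity>"
proof -
  have "(\<integral>\<^sup>+ y. ennreal (exp (- (norm (x - y))\<^sup>2)) \<partial>gauss_weighted N)
      = (\<integral>\<^sup>+ y. ennreal (exp ((norm y)\<^sup>2)) * ennreal (exp (- (norm (x - y))\<^sup>2)) \<partial>N)"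
    unfolding gauss_weighted_def by (rule nn_integral_density) auto
  also have "\<dots> = (\<integral>\<^sup>+ y. ennreal (exp (- (norm x)\<^sup>2)) * ennreal (exp (2 * (x \<bullet> y))) \<partial>N)"
    by (intro nn_integral_cong)
       (simp add: ennreal_mult[symmetric] exp_add[symmetric] power2_norm_eq_inner
          inner_diff_left inner_diff_right inner_commute)
  also have "\<dots> = ennreal (exp (- (norm x)\<^sup>2)) * exp_moment N x"
    unfolding exp_moment_def by (rule nn_integral_cmult) auto
  finally show ?thesis
    unfolding heat_solution_def by (auto simp: ennreal_mult_less_top ennreal_eq_0_iff)
qed

lemma gauss_weighted_in_nonneg_radon:
  fixes N :: "'a::euclidean_space measure"
  assumes sN [measurable_cong]: "sets N = sets borel" and fin: "gauss_moment N (-1) < \<infinity>"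
  shows "gauss_weighted N \<in> nonneg_radon"
proof -
  have "emeasure (gauss_weighted N) C < \<infinity>" if comp: "compact C" for C :: "'a set"
  proof -
    have C: "C \<in> sets N" using comp sN by (simp add: borel_compact)
    obtain R where R: "\<And>y. y \<in> C \<Longrightarrow> norm y \<le> R"
      using compact_imp_bounded[OF comp] by (auto simp: bounded_iff)
    have "emeasure (gauss_weighted N) C = (\<integral>\<^sup>+ y. ennreal (exp ((norm y)\<^sup>2)) * indicator C y \<partial>N)"
      unfolding gauss_weighted_def by (rule emeasure_density) (use C in auto)
    also have "\<dots> \<le> (\<integral>\<^sup>+ y. ennreal (exp (2 * R\<^sup>2)) * ennreal (exp (-1 * (norm y)\<^sup>2)) \<partial>N)"
    proof (rule nn_integral_mono)
      fix y
      have "(norm y)\<^sup>2 \<le> R\<^sup>2" if "y \<in> C"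
        using R[OF that] by (intro power_mono) auto
      then show "ennreal (exp ((norm y)\<^sup>2)) * indicator C y
          \<le> ennreal (exp (2 * R\<^sup>2)) * ennreal (exp (-1 * (norm y)\<^sup>2))"
        by (auto simp: ennreal_mult[symmetric] exp_add[symmetric] indicator_def intro!: ennreal_leI)
    qed
    also have "\<dots> = ennreal (exp (2 * R\<^sup>2)) * gauss_moment N (-1)"
      unfolding gauss_moment_def by (rule nn_integral_cmult) auto
    also have "\<dots> < \<infinity>" using fin by (simp add: ennreal_mult_less_top)
    finally show ?thesis .
  qed
  then show ?thesis by (simp add: nonneg_radon_def gauss_weighted_def sN)
qed

text \<open>Integrating \<open>exp (- \<epsilon> \<bar>y\<bar>\<^sup>2)\<close> against the weighted measure gives the Gaussian moment of
  \<open>N\<close> at \<open>1 - \<epsilon>\<close>, so the threshold \<open>0\<close> for \<open>N\<close> becomes the threshold \<open>1\<close>.\<close>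

lemma optimal_index_gauss_weighted:
  fixes N :: "'a::euclidean_space measure"
  assumes sN [measurable_cong]: "sets N = sets borel"
    and fin: "\<And>\<delta>. \<delta> > 0 \<Longrightarrow> gauss_moment N (- \<delta>) < \<infinity>"
    and inf: "\<And>\<delta>. \<delta> > 0 \<Longrightarrow> gauss_moment N \<delta> = \<infinity>"
  shows "optimal_index (gauss_weighted N) = 1"
proof -
  have rad: "gauss_weighted N \<in> nonneg_radon"
    using gauss_weighted_in_nonneg_radon[OF sN] fin[of 1] by simp
  have "(\<integral>\<^sup>+ y. ennreal (exp (- \<epsilon> * (norm y)\<^sup>2)) \<partial>gauss_weighted N) = gauss_moment N (1 - \<epsilon>)" for \<epsilon>
    unfolding gauss_weighted_def gauss_moment_def
    by (subst nn_integral_density)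
       (auto simp: ennreal_mult[symmetric] exp_add[symmetric] algebra_simps)
  then have eq: "gauss_weighted N \<in> nonneg_radon_eps \<epsilon> \<longleftrightarrow> gauss_moment N (1 - \<epsilon>) < \<infinity>" for \<epsilon>
    by (simp add: nonneg_radon_eps_def rad)
  show ?thesis
    unfolding optimal_index_def
  proof (rule Inf_eqI)
    fix i assume "i \<in> ereal ` {\<epsilon>. \<epsilon> > 0 \<and> gauss_weighted N \<in> nonneg_radon_eps \<epsilon>}"
    then obtain \<epsilon> where "i = ereal \<epsilon>" "gauss_moment N (1 - \<epsilon>) < \<infinity>" by (auto simp: eq)
    then show "1 \<le> i" using inf[of "1 - \<epsilon>"] by (cases "\<epsilon> < 1") auto
  next
    fix z assume z: "\<And>i. i \<in> ereal ` {\<epsilon>. \<epsilon> > 0 \<and> gauss_weighted N \<in> nonneg_radon_eps \<epsilon>} \<Longrightarrow> z \<le> i"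
    have "z \<le> ereal (1 + \<delta>)" if "\<delta> > 0" for \<delta>
      using fin[OF that] that by (intro z imageI) (auto simp: eq)
    then have "z \<le> 1 + ereal \<delta>" if "\<delta> > 0" for \<delta>
      using that by (simp only: plus_ereal.simps(1)[symmetric] one_ereal_def)
    then show "z \<le> 1" by (rule ereal_le_epsilon2)
  qed
qed

text \<open>By \<open>2 x \<bullet> y \<le> \<bar>x\<bar>\<^sup>2 / \<delta> + \<delta> \<bar>y\<bar>\<^sup>2\<close>, an infinite exponential moment at one point already
  forces the positive Gaussian moments to be infinite. Hence only the case of the whole space
  needs a separate argument for them.\<close>

lemma gauss_moment_infinite:
  fixes N :: "'a::euclidean_space measure"
  assumes [measurable_cong]: "sets N = sets borel"
    and inf: "exp_moment N x = \<infinity>" and \<delta>: "\<delta> > 0"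
  shows "gauss_moment N \<delta> = \<infinity>"
proof -
  have "exp_moment N x \<le> (\<integral>\<^sup>+ y. ennreal (exp ((norm x)\<^sup>2 / \<delta>)) * ennreal (exp (\<delta> * (norm y)\<^sup>2)) \<partial>N)"
    unfolding exp_moment_def
  proof (intro nn_integral_mono)
    fix y
    have "0 \<le> (norm (x - \<delta> *\<^sub>R y))\<^sup>2 / \<delta>" using \<delta> by simp
    also have "\<dots> = (norm x)\<^sup>2 / \<delta> + \<delta> * (norm y)\<^sup>2 - 2 * (x \<bullet> y)"
      using \<delta> by (simp add: power2_norm_eq_inner inner_diff_left inner_diff_right
          inner_commute field_simps)
    finally show "ennreal (exp (2 * (x \<bullet> y)))
        \<le> ennreal (exp ((norm x)\<^sup>2 / \<delta>)) * ennreal (exp (\<delta> * (norm y)\<^sup>2))"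
      by (simp add: ennreal_mult[symmetric] exp_add[symmetric])
  qed
  also have "\<dots> = ennreal (exp ((norm x)\<^sup>2 / \<delta>)) * gauss_moment N \<delta>"
    unfolding gauss_moment_def by (rule nn_integral_cmult) auto
  finally show ?thesis
    using inf by (auto simp: top_unique ennreal_mult_eq_top_iff)
qed

section \<open>Discrete measures\<close>

lemma nn_integral_point_masses:
  assumes "f \<in> borel_measurable borel" "\<And>x. f x \<ge> 0" "\<And>i. w i \<ge> 0"
  shows "(\<integral>\<^sup>+ y. ennreal (f y) \<partial>point_masses w p) = (\<integral>\<^sup>+ i. ennreal (w i * f (p i)) \<partial>count_space UNIV)"
proof -
  have "(\<integral>\<^sup>+ y. ennreal (f y) \<partial>point_masses w p)
     = (\<integral>\<^sup>+ i. ennreal (f (p i)) \<partial>density (count_space UNIV) (\<lambda>i. ennreal (w i)))"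
    unfolding point_masses_def by (rule nn_integral_distr) (use assms in auto)
  also have "\<dots> = (\<integral>\<^sup>+ i. ennreal (w i) * ennreal (f (p i)) \<partial>count_space UNIV)"
    by (rule nn_integral_density) auto
  finally show ?thesis using assms by (simp add: ennreal_mult)
qed

lemma sets_point_masses [measurable_cong, simp]: "sets (point_masses w p) = sets borel"
  by (simp add: point_masses_def)

lemma suminf_ennreal_not_null:
  fixes f :: "nat \<Rightarrow> real"
  assumes "\<And>n. f n \<ge> 0" "eventually (\<lambda>n. f n \<ge> 1) sequentially"
  shows "(\<Sum>n. ennreal (f n)) = \<infinity>"
proof (rule ccontr)
  assume "(\<Sum>n. ennreal (f n)) \<noteq> \<infinity>"
  then have "summable f" using assms(1) by (intro summable_suminf_not_top) auto
  then have "f \<longlonglongrightarrow> 0" by (rule summable_LIMSEQ_zero)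
  then have "eventually (\<lambda>n. f n < 1) sequentially" by (rule order_tendstoD) simp
  with assms(2) have "eventually (\<lambda>n. False) sequentially" by eventually_elim simp
  then show False by simp
qed

text \<open>The exponential moments are values of the exponential series. For the Gaussian ones,
  \<open>m! \<le> m\<^sup>m \<le> exp (\<delta> m)\<^sup>m\<close> for large \<open>m\<close>, so the terms do not tend to \<open>0\<close>. The masses are
  those of the Poisson distribution up to the normalising factor \<open>exp (-1)\<close>.\<close>

lemma poisson_masses_moments:
  fixes e :: "'a::euclidean_space"
  assumes e: "norm e = 1"
  defines "N \<equiv> point_masses (\<lambda>m. 1 / fact m) (\<lambda>m. real m *\<^sub>R e)"
  shows "exp_moment N x < \<infinity>" and "\<delta> > 0 \<Longrightarrow> gauss_moment N \<delta> = \<infinity>"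
proof -
  have "exp_moment N x = (\<Sum>m. ennreal (inverse (fact m) * exp (2 * (x \<bullet> e)) ^ m))"
    unfolding exp_moment_def N_def
    by (subst nn_integral_point_masses)
       (auto simp: nn_integral_count_space_nat exp_of_nat_mult[symmetric] field_simps
          intro!: suminf_cong)
  also have "\<dots> < \<infinity>"
    using summable_exp[of "exp (2 * (x \<bullet> e))"]
    by (subst suminf_ennreal2) auto
  finally show "exp_moment N x < \<infinity>" .
  assume \<delta>: "\<delta> > 0"
  have "gauss_moment N \<delta> = (\<Sum>m. ennreal (exp (\<delta> * (real m)\<^sup>2) / fact m))"
    unfolding gauss_moment_def N_def
    by (subst nn_integral_point_masses) (auto simp: nn_integral_count_space_nat e)
  also have "\<dots> = \<infinity>"
  proof (rule suminf_ennreal_not_null)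
    have "eventually (\<lambda>m::nat. real m \<le> exp (\<delta> * real m)) sequentially"
      using \<delta> by real_asymp
    then show "eventually (\<lambda>m. 1 \<le> exp (\<delta> * (real m)\<^sup>2) / fact m) sequentially"
    proof eventually_elim
      case (elim m)
      have "fact m \<le> real m ^ m" by (metis fact_le_power of_nat_fact of_nat_le_iff of_nat_power order_refl)
      also have "\<dots> \<le> exp (\<delta> * real m) ^ m" using elim by (rule power_mono) simp
      also have "\<dots> = exp (\<delta> * (real m)\<^sup>2)"
        by (simp add: exp_of_nat_mult[symmetric] power2_eq_square algebra_simps)
      finally show ?case by simp
    qed
  qed simp
  finally show "gauss_moment N \<delta> = \<infinity>" .
qed

text \<open>The factor \<open>1 / (m + 1)\<^sup>2\<close> is summable but subexponential: with an exponential damping in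
  \<open>m\<close> the moment would stay finite in a neighbourhood of the half-space, with none it would be
  infinite on the bounding hyperplane.\<close>

definition ray_masses :: "(nat \<Rightarrow> 'a::euclidean_space) \<Rightarrow> (nat \<Rightarrow> real) \<Rightarrow> 'a measure" where
  "ray_masses a b = point_masses
     (\<lambda>(k, m). exp (- 2 * real m * b k) * ((1/2) ^ k * inverse (real (Suc m) ^ 2)))
     (\<lambda>(k, m). real m *\<^sub>R a k)"

lemma ray_masses_integral:
  assumes [measurable]: "f \<in> borel_measurable borel" and "\<And>x. f x \<ge> 0"
  shows "(\<integral>\<^sup>+ y. ennreal (f y) \<partial>ray_masses a b)
    = (\<Sum>k. \<Sum>m. ennreal (exp (- 2 * real m * b k) * f (real m *\<^sub>R a k)
                         * ((1/2) ^ k * inverse (real (Suc m) ^ 2))))"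
  unfolding ray_masses_def
  by (subst nn_integral_point_masses)
     (auto simp: assms(2) nn_integral_fst_count_space[symmetric] nn_integral_count_space_nat
       split_beta mult_ac)

lemma ray_masses_finite:
  assumes f: "f \<in> borel_measurable borel" "\<And>x. f x \<ge> 0" and C: "C \<ge> 0"
    and bound: "\<And>k m. exp (- 2 * real m * b k) * f (real m *\<^sub>R a k) \<le> C"
  shows "(\<integral>\<^sup>+ y. ennreal (f y) \<partial>ray_masses a b) < \<infinity>"
proof -
  define s where "s = (\<Sum>m. inverse (real (Suc m) ^ 2))"
  have sm: "summable (\<lambda>m. inverse (real (Suc m) ^ 2))"
    using inverse_power_summable[of 2, where 'a = real] by (subst summable_Suc_iff) auto
  have s0: "s \<ge> 0" unfolding s_def using sm by (intro suminf_nonneg) auto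
  have "(\<integral>\<^sup>+ y. ennreal (f y) \<partial>ray_masses a b)
      \<le> (\<Sum>k. \<Sum>m. ennreal (C * (1/2) ^ k * inverse (real (Suc m) ^ 2)))"
    unfolding ray_masses_integral[OF f]
  proof (intro suminf_le summableI ennreal_leI)
    fix k m
    show "exp (- 2 * real m * b k) * f (real m *\<^sub>R a k) * ((1/2) ^ k * inverse (real (Suc m) ^ 2))
        \<le> C * (1/2) ^ k * inverse (real (Suc m) ^ 2)"
      using mult_right_mono[OF bound, of "(1/2) ^ k * inverse (real (Suc m) ^ 2)" m k]
      by (simp add: mult.assoc)
  qed
  also have "\<dots> = (\<Sum>k. ennreal (C * (1/2) ^ k * s))"
    unfolding s_def using sm C
    by (intro suminf_cong, subst suminf_ennreal2) (auto simp: suminf_mult intro!: summable_mult)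
  also have "\<dots> < \<infinity>"
    using C s0 by (subst suminf_ennreal2) (auto intro!: summable_mult summable_mult2 summable_geometric)
  finally show ?thesis .
qed

text \<open>The \<open>(k, m)\<close> term is \<open>exp (2 m (a\<^sub>k \<bullet> x - b\<^sub>k))\<close> times the damping factor. If every exponent
  is at most \<open>0\<close> the damping factors dominate the series; if some exponent is positive the terms
  along that ray tend to infinity.\<close>

lemma exp_moment_ray_masses:
  "exp_moment (ray_masses a b) x < \<infinity> \<longleftrightarrow> (\<forall>k. a k \<bullet> x \<le> b k)"
proof
  assume le: "\<forall>k. a k \<bullet> x \<le> b k"
  show "exp_moment (ray_masses a b) x < \<infinity>"
    unfolding exp_moment_def
  proof (rule ray_masses_finite[where C = 1])
    fix k m
    have "real m * (a k \<bullet> x) \<le> real m * b k" using le by (intro mult_left_mono) auto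
    then show "exp (- 2 * real m * b k) * exp (2 * (x \<bullet> (real m *\<^sub>R a k))) \<le> 1"
      by (simp add: exp_add[symmetric] inner_commute)
  qed auto
next
  assume fin: "exp_moment (ray_masses a b) x < \<infinity>"
  show "\<forall>k. a k \<bullet> x \<le> b k"
  proof (rule ccontr)
    assume "\<not> (\<forall>k. a k \<bullet> x \<le> b k)"
    then obtain k where k: "a k \<bullet> x > b k" by (auto simp: not_le)
    define c where "c = a k \<bullet> x - b k"
    have c: "c > 0" using k by (simp add: c_def)
    let ?g = "\<lambda>k m. ennreal (exp (- 2 * real m * b k) * exp (2 * (x \<bullet> (real m *\<^sub>R a k)))
                 * ((1/2) ^ k * inverse (real (Suc m) ^ 2)))"
    have "(\<Sum>m. ?g k m) = (\<Sum>m. ennreal (exp (2 * c * real m) * ((1/2) ^ k * inverse (real (Suc m) ^ 2))))"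
      by (intro suminf_cong) (simp add: c_def exp_add[symmetric] inner_commute algebra_simps)
    also have "\<dots> = \<infinity>"
    proof (rule suminf_ennreal_not_null)
      define q :: real where "q = (1/2) ^ k"
      have "q > 0" by (simp add: q_def)
      then show "eventually (\<lambda>m::nat. 1 \<le> exp (2 * c * real m) * ((1/2) ^ k * inverse (real (Suc m) ^ 2))) sequentially"
        unfolding q_def[symmetric] using c by real_asymp
    qed simp
    finally have "\<infinity> = (\<Sum>m. ?g k m)" ..
    also have "\<dots> \<le> (\<Sum>k. \<Sum>m. ?g k m)"
      using sum_le_suminf[OF summableI, of "{k}" "\<lambda>k. \<Sum>m. ?g k m"]
      by (simp only: finite.intros sum.insert sum.empty empty_iff add_0_right zero_le simp_thms)
    also have "\<dots> = exp_moment (ray_masses a b) x"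
      unfolding exp_moment_def by (subst ray_masses_integral) auto
    finally show False using fin by (simp add: top_unique)
  qed
qed

text \<open>The lower bound on the offsets makes the masses grow at most like \<open>exp (2 m M)\<close>, which is
  absorbed by \<open>2 m M - \<delta> m\<^sup>2 \<le> M\<^sup>2 / \<delta>\<close>, uniformly over the rays.\<close>

lemma gauss_moment_ray_masses:
  assumes a: "\<And>k. norm (a k) = 1" and b: "\<And>k. b k \<ge> - M" and \<delta>: "\<delta> > 0"
  shows "gauss_moment (ray_masses a b) (- \<delta>) < \<infinity>"
  unfolding gauss_moment_def
proof (rule ray_masses_finite[where C = "exp (M\<^sup>2 / \<delta>)"])
  fix k m
  have "0 \<le> (M - \<delta> * real m)\<^sup>2 / \<delta>" using \<delta> by simp
  also have "\<dots> = M\<^sup>2 / \<delta> + \<delta> * (real m)\<^sup>2 - 2 * (real m * M)"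
    using \<delta> by (simp add: power2_eq_square field_simps)
  finally have "2 * (real m * M) - \<delta> * (real m)\<^sup>2 \<le> M\<^sup>2 / \<delta>" by simp
  moreover have "real m * (- M) \<le> real m * b k" using b by (intro mult_left_mono) auto
  ultimately show "exp (- 2 * real m * b k) * exp (- \<delta> * (norm (real m *\<^sub>R a k))\<^sup>2) \<le> exp (M\<^sup>2 / \<delta>)"
    by (simp add: exp_add[symmetric] a)
qed auto

section \<open>Convex sets as domains of exponential moments\<close>

text \<open>The open half-spaces missing a nonempty \<open>K\<close> cover its complement by separation, and the
  Lindelof property leaves countably many; their offsets are at least \<open>- \<bar>x\<^sub>0\<bar>\<close> for any
  \<open>x\<^sub>0 \<in> K\<close>. For empty \<open>K\<close> such a subcover could have offsets tending to minus infinity, so an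
  explicit pair of opposite half-spaces is used.\<close>

lemma closed_convex_countable_halfspaces:
  fixes K :: "'a::euclidean_space set"
  assumes "closed K" "convex K" "K \<noteq> UNIV"
  obtains a b M where "\<And>k::nat. norm (a k) = 1" "\<And>k. b k \<ge> - M"
    "K = {x. \<forall>k. a k \<bullet> x \<le> b k}"
proof (cases "K = {}")
  case True
  obtain e :: 'a where e: "norm e = 1" using norm_Basis nonempty_Basis by blast
  define a where "a = (\<lambda>k::nat. if even k then e else - e)"
  have "\<not> (\<forall>k. a k \<bullet> x \<le> -1)" for x
  proof
    assume "\<forall>k. a k \<bullet> x \<le> -1"
    then have "a 0 \<bullet> x \<le> -1" "a 1 \<bullet> x \<le> -1" by blast+
    then show False by (simp add: a_def)
  qed
  then show thesis
    using True e by (intro that[of a 1 "\<lambda>_. -1"]) (auto simp: a_def)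
next
  case False
  then obtain x0 where x0: "x0 \<in> K" by blast
  define F where "F = {{x. a \<bullet> x > b} | a b. norm a = 1 \<and> (\<forall>y\<in>K. a \<bullet> y \<le> b)}"
  have "open S" if "S \<in> F" for S
    using that by (auto simp: F_def open_halfspace_gt)
  then obtain F' where F': "F' \<subseteq> F" "countable F'" "\<Union>F' = \<Union>F" by (rule Lindelof)
  have UF: "\<Union>F = - K"
  proof
    show "\<Union>F \<subseteq> - K" by (force simp: F_def)
    show "- K \<subseteq> \<Union>F"
    proof
      fix z assume "z \<in> - K"
      then obtain a b where ab: "a \<bullet> z < b" "\<And>y. y \<in> K \<Longrightarrow> a \<bullet> y > b"
        using separating_hyperplane_closed_point[OF assms(2,1)] by (metis ComplD)
      have a0: "norm a > 0" using ab x0 by force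
      \<comment> \<open>The separation theorem puts \<open>K\<close> on the upper side and does not normalise \<open>a\<close>.\<close>
      define c where "c = - (a /\<^sub>R norm a)"
      have "norm c = 1" using a0 by (simp add: c_def)
      moreover have "c \<bullet> y \<le> - b / norm a" if "y \<in> K" for y
        using ab(2)[OF that] a0 by (simp add: c_def field_simps)
      moreover have "c \<bullet> z > - b / norm a"
        using ab(1) a0 by (simp add: c_def field_simps)
      ultimately show "z \<in> \<Union>F" unfolding F_def by blast
    qed
  qed
  have ne: "F' \<noteq> {}" using F'(3) UF assms(3) by auto
  have "from_nat_into F' k \<in> F" for k using from_nat_into[OF ne] F'(1) by blast
  then have "\<forall>k. \<exists>a b. from_nat_into F' k = {x. a \<bullet> x > b} \<and> norm a = 1 \<and> (\<forall>y\<in>K. a \<bullet> y \<le> b)"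
    unfolding F_def by blast
  then obtain a b where ab: "\<And>k. from_nat_into F' k = {x. a k \<bullet> x > b k}"
    "\<And>k. norm (a k) = 1" "\<And>k y. y \<in> K \<Longrightarrow> a k \<bullet> y \<le> b k"
    by metis
  have "- K = (\<Union>k. from_nat_into F' k)"
    using range_from_nat_into[OF ne F'(2)] F'(3) UF by simp
  then have K: "K = {x. \<forall>k. a k \<bullet> x \<le> b k}"
    unfolding ab(1) by (auto simp: not_less set_eq_iff) (meson not_le)+
  have "b k \<ge> - norm x0" for k
  proof -
    have "- norm x0 \<le> a k \<bullet> x0"
      using Cauchy_Schwarz_ineq2[of "a k" x0] ab(2) by (simp add: abs_le_iff)
    also have "\<dots> \<le> b k" by (rule ab(3)[OF x0])
    finally show ?thesis .
  qed
  then show thesis using ab(2) K by (intro that[of a "norm x0" b])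
qed

text \<open>The case distinction is needed because the whole space is not the intersection of a nonempty
  family of half-spaces.\<close>

lemma exp_moment_domain:
  fixes K :: "'a::euclidean_space set"
  assumes "closed K" "convex K"
  obtains N :: "'a measure" where "sets N = sets borel"
    "\<And>x. exp_moment N x < \<infinity> \<longleftrightarrow> x \<in> K"
    "\<And>\<delta>. \<delta> > 0 \<Longrightarrow> gauss_moment N (- \<delta>) < \<infinity>"
    "\<And>\<delta>. \<delta> > 0 \<Longrightarrow> gauss_moment N \<delta> = \<infinity>"
proof (cases "K = UNIV")
  case True
  obtain e :: 'a where e: "norm e = 1" using norm_Basis nonempty_Basis by blast
  define N where "N = point_masses (\<lambda>m. 1 / fact m) (\<lambda>m. real m *\<^sub>R e)"
  have fin: "exp_moment N x < \<infinity>" and inf: "\<delta> > 0 \<Longrightarrow> gauss_moment N \<delta> = \<infinity>" for x \<delta>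
    unfolding N_def by (fact poisson_masses_moments[OF e])+
  have "gauss_moment N (- \<delta>) < \<infinity>" if "\<delta> > 0" for \<delta>
  proof -
    have "gauss_moment N (- \<delta>) \<le> exp_moment N 0"
      unfolding gauss_moment_def exp_moment_def using that by (intro nn_integral_mono) simp
    then show ?thesis using fin[of 0] by (rule le_less_trans)
  qed
  then show thesis using True fin inf by (intro that[of N]) (auto simp: N_def)
next
  case False
  obtain a b M where ab: "\<And>k::nat. norm (a k :: 'a) = 1" "\<And>k. b k \<ge> - M"
    and K: "K = {x. \<forall>k. a k \<bullet> x \<le> b k}"
    by (rule closed_convex_countable_halfspaces[OF assms False]) (rule that)
  define N where "N = ray_masses a b"
  have sN: "sets N = sets borel" by (simp add: N_def ray_masses_def)
  have dom: "exp_moment N x < \<infinity> \<longleftrightarrow> x \<in> K" for x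
    unfolding N_def exp_moment_ray_masses K by simp
  obtain x where "x \<notin> K" using False by blast
  then have "exp_moment N x = \<infinity>" using dom[of x] by (simp add: less_top[symmetric])
  then show thesis
    using gauss_moment_infinite[OF sN] dom gauss_moment_ray_masses[of a M b] ab sN
    by (intro that[of N]) (auto simp: N_def)
qed

theorem mainTheorem8:
  fixes K :: "'a::euclidean_space set"
  assumes "closed K" and "convex K"
  shows "\<exists>u0 :: 'a measure.
           u0 \<in> nonneg_radon \<and>
           0 < optimal_index u0 \<and> optimal_index u0 < \<infinity> \<and>
           (let T = 1 / (4 * real_of_ereal (optimal_index u0)) in
              \<forall>x. \<exists>L. (heat_solution u0 x \<longlongrightarrow> L) (at_left T) \<and> (L < \<infinity> \<longleftrightarrow> x \<in> K))"
proof -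
  obtain N :: "'a measure" where sN: "sets N = sets borel"
    and dom: "\<And>x. exp_moment N x < \<infinity> \<longleftrightarrow> x \<in> K"
    and fin: "\<And>\<delta>. \<delta> > 0 \<Longrightarrow> gauss_moment N (- \<delta>) < \<infinity>"
    and inf: "\<And>\<delta>. \<delta> > 0 \<Longrightarrow> gauss_moment N \<delta> = \<infinity>"
    by (rule exp_moment_domain[OF assms]) (rule that)
  define u0 where "u0 = gauss_weighted N"
  have idx: "optimal_index u0 = 1"
    unfolding u0_def by (rule optimal_index_gauss_weighted[OF sN fin inf])
  have "u0 \<in> nonneg_radon"
    unfolding u0_def using gauss_weighted_in_nonneg_radon[OF sN] fin[of 1] by simp
  moreover have "sets u0 = sets borel" by (simp add: u0_def gauss_weighted_def sN)
  then have "(heat_solution u0 x \<longlongrightarrow> heat_solution u0 x (1/4)) (at_left (1/4))" for x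
    by (rule heat_solution_left_continuous) simp
  moreover have "heat_solution u0 x (1/4) < \<infinity> \<longleftrightarrow> x \<in> K" for x
    unfolding u0_def by (simp only: heat_solution_gauss_weighted[OF sN] dom)
  ultimately show ?thesis
    by (intro exI[of _ u0]) (auto simp: idx Let_def)
qed

end
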